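(* Let $\mathbf{k}=(k_1,\dots,k_n)\in\mathbb{N}^n$ satisfy $k_1>k_2>\cdots>k_n\ge 1$, $k_1>n$ and $\gcd(k_1,\dots,k_n)=1$. Then: (1) If $\mathbf{k}$ is symmetric, the group $\mathcal{V}_{\mathbf{k}}$ is generated by $\mathcal{H}_{\mathbf{k}}$ and the class $[J_n]$ of the anti-diagonal matrix $J_n$ (the $(n+1)\times(n+1)$ matrix with $1$s on the anti-diagonal and $0$s elsewhere), that is, $\mathcal{V}_{\mathbf{k}}=\langle\mathcal{H}_{\mathbf{k}},[J_n]\rangle$. (2) If $\mathbf{k}$ is not symmetric, then $\mathcal{V}_{\mathbf{k}}=\mathcal{H}_{\mathbf{k}}$.
   Context: For a tuple $\mathbf{k}=(k_1,\ldots,k_n)$ of natural numbers with $k_1>\cdots>k_n>0$, let $\xi_{\mathbf{k}}:\mathbb{CP}^1\to\mathbb{CP}^n$ be the monomial curve $\xi_{\mathbf{k}}([z:w])=[z^{k_1}:z^{k_2}w^{k_1-k_2}:\cdots:z^{k_n}w^{k_1-k_n}:w^{k_1}]$ and let $S^{(\mathbf{k})}\subset\mathbb{CP}^n$ be its image. Define $\mathcal{V}_{\mathbf{k}}=\{g\in\mathrm{PSL}(n+1,\mathbb{C}) : g\cdot S^{(\mathbf{k})}=S^{(\mathbf{k})}\}$, where $\mathrm{PSL}(n+1,\mathbb{C})=\mathrm{PGL}(n+1,\mathbb{C})$ acts on $\mathbb{CP}^n$ in the standard way, and $\mathcal{H}_{\mathbf{k}}=\{[\operatorname{diag}(\alpha^{k_1},\alpha^{k_2}\beta^{k_1-k_2},\ldots,\alpha^{k_n}\beta^{k_1-k_n},\beta^{k_1})]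 : \alpha,\beta\in\mathbb{C}^*\}$, where $[\cdot]$ denotes the class of an invertible matrix modulo scalars. A tuple $\mathbf{k}=(k_1,\ldots,k_n)\in\mathbb{Z}^n$ is called symmetric if $k_1>k_2>\cdots>k_n\ge 1$, $\gcd(k_1,\ldots,k_n)=1$, and, setting $k_{n+1}=0$, one has $k_{n-j}-k_{n-j+1}=k_{j+1}-k_{j+2}$ for all $0\le j\le n-2$. *)

theory Defs
  imports
    "Jordan_Normal_Form.Determinant"
    "HOL-Algebra.Generated_Groups"
begin

subsection \<open>The group \<open>PGL\<close> and projective space\<close>

definition GL :: "nat \<Rightarrow> complex mat monoid" where
  "GL m = units_of (ring_mat TYPE(complex) m ())"

definition scalar_mats :: "nat \<Rightarrow> complex mat set" where
  "scalar_mats m = {c \<cdot>\<^sub>m 1\<^sub>m m | c. c \<noteq> 0}"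

definition PGL :: "nat \<Rightarrow> complex mat set monoid" where
  "PGL m = GL m Mod scalar_mats m"

definition mat_class :: "nat \<Rightarrow> complex mat \<Rightarrow> complex mat set" where
  "mat_class m A = scalar_mats m #>\<^bsub>GL m\<^esub> A"

text \<open>A point of projective space is the set of all nonzero multiples of a nonzero vector,
  so the origin does not belong to it.\<close>

definition proj_pt :: "complex vec \<Rightarrow> complex vec set" where
  "proj_pt v = {c \<cdot>\<^sub>v v | c. c \<noteq> 0}"

definition CP :: "nat \<Rightarrow> complex vec set set" where
  "CP n = proj_pt ` (carrier_vec (n + 1) - {0\<^sub>v (n + 1)})"

definition pgl_act :: "complex mat set \<Rightarrow> complex vec set \<Rightarrow> complex vec set" where
  "pgl_act g p = {A *\<^sub>v v | A v. A \<in> g \<and> v \<in> p}"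


subsection \<open>Monomial curves\<close>

text \<open>A tuple \<open>(k\<^sub>1, \<dots>, k\<^sub>n)\<close> is a list of length \<open>n\<close>. The entry function is
  one-based and extends the tuple by \<open>k\<^sub>n\<^sub>+\<^sub>1 = 0\<close>.\<close>

definition entry :: "nat list \<Rightarrow> nat \<Rightarrow> nat" where
  "entry k i = (if 1 \<le> i \<and> i \<le> length k then k ! (i - 1) else 0)"

text \<open>Vector and matrix indices start at zero, so coordinate \<open>i\<close> carries
  \<open>z ^ k\<^sub>i\<^sub>+\<^sub>1 * w ^ (k\<^sub>1 - k\<^sub>i\<^sub>+\<^sub>1)\<close>. The last one is \<open>w ^ k\<^sub>1\<close> since \<open>k\<^sub>n\<^sub>+\<^sub>1 = 0\<close>.\<close>

definition monomial :: "nat list \<Rightarrow> complex \<Rightarrow> complex \<Rightarrow> nat \<Rightarrow> complex" where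
  "monomial k z w i = z ^ entry k (i + 1) * w ^ (entry k 1 - entry k (i + 1))"

definition monomial_curve :: "nat list \<Rightarrow> complex vec set \<Rightarrow> complex vec set" where
  "monomial_curve k p =
     (\<Union>v\<in>p. proj_pt (vec (length k + 1) (monomial k (v $ 0) (v $ 1))))"

definition curve_image :: "nat list \<Rightarrow> complex vec set set" where
  "curve_image k = monomial_curve k ` CP 1"

definition V_group :: "nat list \<Rightarrow> complex mat set set" where
  "V_group k =
     {g \<in> carrier (PGL (length k + 1)). pgl_act g ` curve_image k = curve_image k}"

definition H_group :: "nat list \<Rightarrow> complex mat set set" where
  "H_group k =
     {mat_class (length k + 1) (mat_diag (length k + 1) (monomial k a b)) | a b.
        a \<noteq> 0 \<and> b \<noteq> 0}"

definition antidiag_mat :: "nat \<Rightarrow> complex mat" where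
  "antidiag_mat n = mat (n + 1) (n + 1) (\<lambda>(i, j). if i + j = n then 1 else 0)"

text \<open>The truncated subtractions are exact because the tuple is decreasing.\<close>

definition symmetric_tuple :: "nat list \<Rightarrow> bool" where
  "symmetric_tuple k \<longleftrightarrow>
     sorted_wrt (>) k \<and> (\<forall>x\<in>set k. 1 \<le> x) \<and> Gcd (set k) = 1 \<and>
     (\<forall>j. j + 2 \<le> length k \<longrightarrow>
        entry k (length k - j) - entry k (length k - j + 1) = entry k (j + 1) - entry k (j + 2))"


subsection \<open>Well-definedness\<close>

lemma GL_simps:
  "carrier (GL m) = Units (ring_mat TYPE(complex) m ())"
  "A \<otimes>\<^bsub>GL m\<^esub> B = A * B"
  "\<one>\<^bsub>GL m\<^esub> = 1\<^sub>m m"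
  by (simp_all add: GL_def units_of_def ring_mat_simps)

lemma carrier_GL: "carrier (GL m) = {A \<in> carrier_mat m m. det A \<noteq> 0}"
proof (intro equalityI subsetI)
  fix A assume "A \<in> carrier (GL m)"
  then show "A \<in> {A \<in> carrier_mat m m. det A \<noteq> 0}"
    using unit_imp_det_non_zero[of A m "()"] by (auto simp: GL_simps Units_def ring_mat_simps)
next
  fix A :: "complex mat" assume "A \<in> {A \<in> carrier_mat m m. det A \<noteq> 0}"
  then show "A \<in> carrier (GL m)" using det_non_zero_imp_unit[of A m "()"] by (auto simp: GL_simps)
qed

lemma group_GL: "group (GL m)"
proof -
  interpret ring "ring_mat TYPE(complex) m ()" by (rule ring_mat)
  show ?thesis unfolding GL_def by (rule units_group)
qed

lemma scalar_mats_normal: "scalar_mats m \<lhd> GL m"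
proof -
  interpret group "GL m" by (rule group_GL)
  have sub: "scalar_mats m \<subseteq> carrier (GL m)"
    by (auto simp: scalar_mats_def carrier_GL det_smult)
  have cl: "x \<otimes>\<^bsub>GL m\<^esub> y \<in> scalar_mats m" if xy: "x \<in> scalar_mats m" "y \<in> scalar_mats m" for x y
  proof -
    obtain a b where "x = a \<cdot>\<^sub>m 1\<^sub>m m" "y = b \<cdot>\<^sub>m 1\<^sub>m m" and ab: "a \<noteq> 0" "b \<noteq> 0"
      using xy by (auto simp: scalar_mats_def)
    then have "x * y = (a * b) \<cdot>\<^sub>m 1\<^sub>m m" by (intro eq_matI) auto
    with ab show ?thesis by (auto simp: scalar_mats_def GL_simps intro!: exI[of _ "a * b"])
  qed
  have inv: "inv\<^bsub>GL m\<^esub> x \<in> scalar_mats m" if x: "x \<in> scalar_mats m" for x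
  proof -
    obtain a where a: "x = a \<cdot>\<^sub>m 1\<^sub>m m" "a \<noteq> 0" using x by (auto simp: scalar_mats_def)
    let ?y = "inverse a \<cdot>\<^sub>m (1\<^sub>m m :: complex mat)"
    have y: "?y \<in> scalar_mats m" using a by (auto simp: scalar_mats_def intro!: exI[of _ "inverse a"])
    have "?y * x = 1\<^sub>m m" using a by (intro eq_matI) auto
    then have "inv\<^bsub>GL m\<^esub> x = ?y"
      using x y sub by (intro inv_equality) (auto simp: GL_simps)
    with y show ?thesis by simp
  qed
  have "\<one>\<^bsub>GL m\<^esub> \<in> scalar_mats m"
    by (auto simp: scalar_mats_def GL_simps intro!: exI[of _ 1])
  then have sg: "subgroup (scalar_mats m) (GL m)"
    using sub cl inv by (intro subgroupI) auto
  have "x \<otimes>\<^bsub>GL m\<^esub> h \<otimes>\<^bsub>GL m\<^esub> inv\<^bsub>GL m\<^esub> x \<in> scalar_mats m"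
    if xh: "x \<in> carrier (GL m)" "h \<in> scalar_mats m" for x h
  proof -
    obtain a where a: "h = a \<cdot>\<^sub>m 1\<^sub>m m" using xh by (auto simp: scalar_mats_def)
    have "x \<in> carrier_mat m m" using xh by (auto simp: carrier_GL)
    then have "x * h = h * x" using a
      by (simp add: mult_smult_distrib[of x m m "1\<^sub>m m" m] mult_smult_assoc_mat[of "1\<^sub>m m" m m])
    then have "x \<otimes>\<^bsub>GL m\<^esub> h \<otimes>\<^bsub>GL m\<^esub> inv\<^bsub>GL m\<^esub> x = h \<otimes>\<^bsub>GL m\<^esub> (x \<otimes>\<^bsub>GL m\<^esub> inv\<^bsub>GL m\<^esub> x)"
      using xh sub by (subst m_assoc[symmetric]) (auto simp: GL_simps(2))
    then have "x \<otimes>\<^bsub>GL m\<^esub> h \<otimes>\<^bsub>GL m\<^esub> inv\<^bsub>GL m\<^esub> x = h" using xh sub by (simp add: subset_iff)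
    with xh show ?thesis by simp
  qed
  with sg show ?thesis by (simp add: normal_inv_iff)
qed

lemma group_PGL: "group (PGL m)"
  unfolding PGL_def by (rule normal.factorgroup_is_group[OF scalar_mats_normal])

lemma mat_class_eq:
  assumes "A \<in> carrier_mat m m"
  shows "mat_class m A = {c \<cdot>\<^sub>m A | c. c \<noteq> 0}"
proof -
  have "c \<cdot>\<^sub>m 1\<^sub>m m * A = c \<cdot>\<^sub>m A" for c
    using assms by (simp add: mult_smult_assoc_mat[of "1\<^sub>m m" m m])
  then have "mat_class m A = (\<lambda>c. c \<cdot>\<^sub>m A) ` {c. c \<noteq> 0}"
    by (simp add: mat_class_def r_coset_def GL_simps scalar_mats_def setcompr_eq_image
        UNION_singleton_eq_range image_image)
  then show ?thesis by (simp add: setcompr_eq_image)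
qed

lemma carrier_PGL: "carrier (PGL m) = mat_class m ` carrier (GL m)"
  by (simp add: PGL_def carrier_FactGroup mat_class_def)

lemma proj_pt_smult: "c \<noteq> 0 \<Longrightarrow> proj_pt (c \<cdot>\<^sub>v v) = proj_pt v"
proof -
  assume c: "c \<noteq> 0"
  show ?thesis
  proof (intro equalityI subsetI)
    fix u assume "u \<in> proj_pt (c \<cdot>\<^sub>v v)"
    then obtain a where a: "a \<noteq> 0" "u = (a * c) \<cdot>\<^sub>v v"
      by (auto simp: proj_pt_def smult_smult_assoc)
    show "u \<in> proj_pt v" unfolding proj_pt_def
      by (rule CollectI, rule exI[of _ "a * c"]) (use a c in simp)
  next
    fix u assume "u \<in> proj_pt v"
    then obtain a where a: "a \<noteq> 0" "u = a \<cdot>\<^sub>v v" by (auto simp: proj_pt_def)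
    show "u \<in> proj_pt (c \<cdot>\<^sub>v v)" unfolding proj_pt_def
      by (rule CollectI, rule exI[of _ "a / c"]) (use a c in \<open>simp add: smult_smult_assoc\<close>)
  qed
qed

lemma pgl_act_mat_class:
  assumes A: "A \<in> carrier_mat m m" and v: "v \<in> carrier_vec m"
  shows "pgl_act (mat_class m A) (proj_pt v) = proj_pt (A *\<^sub>v v)"
proof -
  have eq: "(c \<cdot>\<^sub>m A) *\<^sub>v (d \<cdot>\<^sub>v v) = (c * d) \<cdot>\<^sub>v (A *\<^sub>v v)" for c d
    using A v by (intro eq_vecI) (auto simp: scalar_prod_def sum_distrib_left algebra_simps)
  show ?thesis
  proof (intro equalityI subsetI)
    fix u assume "u \<in> pgl_act (mat_class m A) (proj_pt v)"
    then obtain c d where cd: "c \<noteq> 0" "d \<noteq> 0" "u = (c * d) \<cdot>\<^sub>v (A *\<^sub>v v)"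
      unfolding pgl_act_def mat_class_eq[OF A] proj_pt_def using eq by blast
    show "u \<in> proj_pt (A *\<^sub>v v)" unfolding proj_pt_def
      by (rule CollectI, rule exI[of _ "c * d"]) (use cd in simp)
  next
    fix u assume "u \<in> proj_pt (A *\<^sub>v v)"
    then obtain c where "c \<noteq> 0" "u = c \<cdot>\<^sub>v (A *\<^sub>v v)" by (auto simp: proj_pt_def)
    then have "u = (c \<cdot>\<^sub>m A) *\<^sub>v (1 \<cdot>\<^sub>v v)" using eq[of c 1] by simp
    moreover have "c \<cdot>\<^sub>m A \<in> mat_class m A"
      unfolding mat_class_eq[OF A] using \<open>c \<noteq> 0\<close> by blast
    moreover have "1 \<cdot>\<^sub>v v \<in> proj_pt v" unfolding proj_pt_def using one_neq_zero by blast
    ultimately show "u \<in> pgl_act (mat_class m A) (proj_pt v)"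
      unfolding pgl_act_def by blast
  qed
qed

lemma monomial_curve_proj_pt:
  assumes k: "sorted_wrt (>) k" and v: "v \<in> carrier_vec 2"
  shows "monomial_curve k (proj_pt v) =
    proj_pt (vec (length k + 1) (monomial k (v $ 0) (v $ 1)))"
proof -
  have le: "entry k (i + 1) \<le> entry k 1" for i
    by (cases "i = 0"; cases "i < length k")
      (use sorted_wrt_nth_less[OF k, of 0 i] in \<open>simp_all add: entry_def\<close>)
  have "monomial k (c * v $ 0) (c * v $ 1) i = c ^ entry k 1 * monomial k (v $ 0) (v $ 1) i" for c i
  proof -
    have "c ^ entry k 1 = c ^ entry k (i + 1) * c ^ (entry k 1 - entry k (i + 1))"
      using le[of i] by (metis le_add_diff_inverse power_add)
    then show ?thesis by (simp add: monomial_def power_mult_distrib)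
  qed
  then have "vec (length k + 1) (monomial k ((c \<cdot>\<^sub>v v) $ 0) ((c \<cdot>\<^sub>v v) $ 1)) =
      (c ^ entry k 1) \<cdot>\<^sub>v vec (length k + 1) (monomial k (v $ 0) (v $ 1))" for c
    using v by (intro eq_vecI) auto
  then have "proj_pt (vec (length k + 1) (monomial k (u $ 0) (u $ 1))) =
      proj_pt (vec (length k + 1) (monomial k (v $ 0) (v $ 1)))" if "u \<in> proj_pt v" for u
    using that by (auto simp: proj_pt_def[of v] proj_pt_smult)
  moreover have "v \<in> proj_pt v" by (auto simp: proj_pt_def intro!: exI[of _ 1])
  ultimately show ?thesis unfolding monomial_curve_def by blast
qed

end

theory Submission
  imports Defs "HOL-Computational_Algebra.Fundamental_Theorem_Algebra"
begin

text \<open>Write \<open>e\<^sub>0 > \<dots> > e\<^sub>n = 0\<close> for the exponents, \<open>d = e\<^sub>0\<close> for the degree, and let the invertible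
  matrix \<open>A\<close> map the curve into itself. The image of the affine point with parameter \<open>t\<close> has
  polynomial coordinates \<open>q\<^sub>i(t) = \<Sum>\<^sub>j A\<^sub>i\<^sub>j t^e\<^sub>j\<close>. Since this point lies on the curve, the binomial
  equations of the curve give \<open>q\<^sub>i^d = q\<^sub>0^e\<^sub>i q\<^sub>n^(d - e\<^sub>i)\<close>, and \<open>q\<^sub>0\<close> and \<open>q\<^sub>n\<close> have no common root.
  Hence \<open>d\<close> divides \<open>e\<^sub>i m\<close> for every \<open>i\<close> whenever \<open>m\<close> is the order of a root of \<open>q\<^sub>0\<close>, and since the
  exponents are coprime, \<open>d\<close> divides \<open>m\<close>; the same holds for \<open>q\<^sub>n\<close>. Both polynomials have degree
  at most \<open>d\<close>, so each is constant or of the form \<open>c (t - r)^d\<close>. If \<open>r \<noteq> 0\<close>, all \<open>d + 1\<close> powers of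
  \<open>t\<close> would occur in it, although only \<open>n + 1 < d + 1\<close> of them are available; so \<open>r = 0\<close>.

  Thus \<open>q\<^sub>0\<close> and \<open>q\<^sub>n\<close> are, up to constants, \<open>1\<close> or \<open>t^d\<close>, and invertibility together with the absence
  of a common root leaves \<open>(t^d, 1)\<close> and \<open>(1, t^d)\<close> (\<open>row_polys_monom\<close>). The binomial equations now
  make each \<open>q\<^sub>i\<close> a monomial, of degree \<open>e\<^sub>i\<close> in the first case and \<open>d - e\<^sub>i\<close> in the second. In
  the first case \<open>A\<close> is diagonal. In the second case the set of exponents is closed under
  \<open>e \<mapsto> d - e\<close>, which forces the tuple to be symmetric and \<open>A\<close> to be a diagonal matrix times the
  anti-diagonal one. The diagonal entries are the coordinates of a point of the curve, the image
  of \<open>t = 1\<close>, so the diagonal factor has its class in \<open>H_group\<close> (\<open>mat_class_cases\<close>).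

  Conversely, the diagonal matrices rescale the homogeneous parameters of the curve, and if the
  tuple is symmetric, the anti-diagonal matrix exchanges them.\<close>

section \<open>Polynomials with constrained roots\<close>

lemma order_power:
  fixes p :: "'a::idom poly"
  assumes "p \<noteq> 0"
  shows "Polynomial.order a (p ^ m) = m * Polynomial.order a p"
  by (induction m) (use assms in \<open>auto simp: order_mult\<close>)

text \<open>A nonconstant polynomial has a root; its order is a positive multiple of \<open>d\<close>, which already
  exhausts the degree.\<close>

lemma poly_power_linear_if_orders_divisible:
  fixes p :: "complex poly"
  assumes "p \<noteq> 0" and "degree p \<le> d" and "\<And>r. d dvd Polynomial.order r p"
  shows "(\<exists>c. p = [:c:]) \<or> (\<exists>c r. c \<noteq> 0 \<and> p = smult c ([:- r, 1:] ^ d))"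
proof (cases "constant (poly p)")
  case True
  then show ?thesis by (auto simp: constant_degree elim: degree_eq_zeroE)
next
  case False
  then obtain r where "poly p r = 0" using fundamental_theorem_of_algebra by blast
  with assms(1) have "Polynomial.order r p > 0" by (simp add: order_gt_0_iff)
  with assms(3)[of r] have "d \<le> Polynomial.order r p" by (simp add: dvd_imp_le)
  then have "[:- r, 1:] ^ d dvd p" by (simp add: order_divides)
  then obtain s where s: "p = [:- r, 1:] ^ d * s" by (elim dvdE)
  with assms(1) have "s \<noteq> 0" by auto
  then have "degree p = d + degree s"
    unfolding s by (subst degree_mult_eq) (auto simp: degree_linear_power)
  with assms(2) have "degree s = 0" by simp
  then obtain c where "s = [:c:]" by (elim degree_eq_zeroE)
  with s \<open>s \<noteq> 0\<close> have "c \<noteq> 0 \<and> p = smult c ([:- r, 1:] ^ d)" by auto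
  then show ?thesis by blast
qed

text \<open>The degree of \<open>p\<close> and its order at \<open>0\<close> both equal \<open>m\<close>, which leaves a single term.\<close>

lemma monom_if_power_monom:
  fixes p :: "'a::idom poly"
  assumes eq: "p ^ d = monom c (d * m)" and "c \<noteq> 0" and "d > 0"
  shows "\<exists>b. b \<noteq> 0 \<and> p = monom b m"
proof -
  have p: "p \<noteq> 0" using assms by (metis monom_eq_0_iff power_0_left neq0_conv)
  have "d * degree p = d * m"
    using arg_cong[OF eq, of degree] p \<open>c \<noteq> 0\<close> by (simp add: degree_power_eq degree_monom_eq)
  then have deg: "degree p = m" using \<open>d > 0\<close> by simp
  have "d * Polynomial.order 0 p = d * m"
    using arg_cong[OF eq, of "Polynomial.order 0"] p \<open>c \<noteq> 0\<close> by (simp add: order_power)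
  then have "[:- 0, 1:] ^ m dvd p" using \<open>d > 0\<close> by (subst order_divides) simp
  then obtain s where s: "p = monom 1 m * s" by (auto simp: monom_altdef elim!: dvdE)
  with p have "s \<noteq> 0" by auto
  then have "degree p = m + degree s"
    unfolding s by (subst degree_mult_eq) (auto simp: degree_monom_eq)
  with deg have "degree s = 0" by simp
  then obtain b where "s = [:b:]" by (elim degree_eq_zeroE)
  with s \<open>s \<noteq> 0\<close> have "b \<noteq> 0 \<and> p = monom b m" by (auto simp: smult_monom)
  then show ?thesis by blast
qed


section \<open>Matrix classes and their action\<close>

lemma mat_class_mult:
  assumes "A \<in> carrier (GL m)" and "B \<in> carrier (GL m)"
  shows "mat_class m A \<otimes>\<^bsub>PGL m\<^esub> mat_class m B = mat_class m (A * B)"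
  using normal.rcos_sum[OF scalar_mats_normal assms]
  by (simp add: PGL_def FactGroup_def mat_class_def GL_simps)

lemma PGL_one: "\<one>\<^bsub>PGL m\<^esub> = mat_class m (1\<^sub>m m)"
proof -
  have "mat_class m (1\<^sub>m m) = scalar_mats m"
    by (subst mat_class_eq) (auto simp: scalar_mats_def)
  then show ?thesis by (simp add: PGL_def)
qed

lemma mat_class_smult:
  assumes "B \<in> carrier_mat m m" and "c \<noteq> 0"
  shows "mat_class m (c \<cdot>\<^sub>m B) = mat_class m B"
proof -
  have "\<exists>b. b \<noteq> 0 \<and> a \<cdot>\<^sub>m B = (b * c) \<cdot>\<^sub>m B" if "a \<noteq> 0" for a
    using that assms(2) by (intro exI[of _ "a / c"]) simp
  moreover have "b \<cdot>\<^sub>m (c \<cdot>\<^sub>m B) = (b * c) \<cdot>\<^sub>m B" for b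
    by (intro eq_matI) auto
  ultimately show ?thesis
    using assms by (auto simp: mat_class_eq)
qed

lemma pgl_act_mult:
  assumes "g \<in> carrier (PGL m)" and "h \<in> carrier (PGL m)" and v: "v \<in> carrier_vec m"
  shows "pgl_act (g \<otimes>\<^bsub>PGL m\<^esub> h) (proj_pt v) = pgl_act g (pgl_act h (proj_pt v))"
proof -
  obtain A B where AB: "A \<in> carrier (GL m)" "g = mat_class m A"
    "B \<in> carrier (GL m)" "h = mat_class m B"
    using assms by (auto simp: carrier_PGL)
  then have "A \<in> carrier_mat m m" "B \<in> carrier_mat m m" by (auto simp: carrier_GL)
  with AB v show ?thesis
    by (simp add: mat_class_mult pgl_act_mat_class[of _ m] assoc_mult_mat_vec[of A m m B m])
qed

lemma carrier_GL_if_inverse: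
  assumes "A \<in> carrier_mat m m" and "B \<in> carrier_mat m m" and "B * A = 1\<^sub>m m"
  shows "A \<in> carrier (GL m)"
proof -
  have "det B * det A = 1" using assms by (metis det_mult det_one)
  with assms(1) show ?thesis by (auto simp: carrier_GL)
qed

lemma antidiag_mult_vec:
  assumes "v \<in> carrier_vec (Suc n)"
  shows "antidiag_mat n *\<^sub>v v = vec (Suc n) (\<lambda>i. v $ (n - i))"
proof (rule eq_vecI)
  fix i assume "i < dim_vec (vec (Suc n) (\<lambda>i. v $ (n - i)))"
  then have i: "i \<le> n" by simp
  have "(antidiag_mat n *\<^sub>v v) $ i = (\<Sum>j\<in>{0..<Suc n}. if j = n - i then v $ j else 0)"
    unfolding antidiag_mat_def using i assms
    by (auto simp: scalar_prod_def simp del: sum.op_ivl_Suc sum.delta sum.delta' intro!: sum.cong)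
  then show "(antidiag_mat n *\<^sub>v v) $ i = vec (Suc n) (\<lambda>i. v $ (n - i)) $ i"
    using i by (simp add: sum.delta del: sum.op_ivl_Suc)
qed (simp add: antidiag_mat_def)

lemma antidiag_GL: "antidiag_mat n \<in> carrier (GL (Suc n))"
proof (rule carrier_GL_if_inverse)
  show "antidiag_mat n * antidiag_mat n = 1\<^sub>m (Suc n)"
  proof (rule eq_matI)
    fix i j assume "i < dim_row (1\<^sub>m (Suc n) :: complex mat)" "j < dim_col (1\<^sub>m (Suc n) :: complex mat)"
    then have ij: "i \<le> n" "j \<le> n" by auto
    have "(antidiag_mat n * antidiag_mat n) $$ (i, j) = (antidiag_mat n *\<^sub>v col (antidiag_mat n) j) $ i"
      using ij by (simp add: antidiag_mat_def)
    also have "\<dots> = antidiag_mat n $$ (n - i, j)"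
      using ij by (subst antidiag_mult_vec) (auto simp: antidiag_mat_def)
    finally show "(antidiag_mat n * antidiag_mat n) $$ (i, j) = 1\<^sub>m (Suc n) $$ (i, j)"
      using ij by (auto simp: antidiag_mat_def)
  qed (auto simp: antidiag_mat_def)
qed (auto simp: antidiag_mat_def)


section \<open>The exponents of the curve\<close>

text \<open>Counting steps from the left end gives \<open>s i \<le> n - i\<close>, counting them from the right end gives
  the reverse inequality.\<close>

lemma strict_antimono_endo_is_reflection:
  fixes s :: "nat \<Rightarrow> nat"
  assumes le: "\<And>i. i \<le> n \<Longrightarrow> s i \<le> n"
    and anti: "\<And>i j. i < j \<Longrightarrow> j \<le> n \<Longrightarrow> s j < s i"
    and "i \<le> n"
  shows "s i = n - i"
proof -
  have up: "s i + i \<le> n" if "i \<le> n" for i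
    using that
  proof (induction i)
    case 0 then show ?case using le[of 0] by simp
  next
    case (Suc i) then show ?case using anti[of i "Suc i"] by simp
  qed
  have down: "j \<le> s (n - j)" if "j \<le> n" for j
    using that
  proof (induction j)
    case (Suc j) then show ?case using anti[of "n - Suc j" "n - j"] by fastforce
  qed simp
  show ?thesis using up[of i] down[of "n - i"] \<open>i \<le> n\<close> by simp
qed

locale exponent_tuple =
  fixes k :: "nat list"
  assumes nonempty: "k \<noteq> []"
    and decreasing: "sorted_wrt (>) k"
    and positive: "\<forall>x\<in>set k. 1 \<le> x"
begin

abbreviation "n \<equiv> length k"
abbreviation "expo i \<equiv> entry k (Suc i)"
abbreviation "d \<equiv> expo 0"
abbreviation "pt z w \<equiv> vec (Suc n) (monomial k z w)"

lemma expo_length: "expo n = 0"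
  by (simp add: entry_def)

lemma expo_less: "i < j \<Longrightarrow> j \<le> n \<Longrightarrow> expo j < expo i"
  using sorted_wrt_nth_less[OF decreasing, of i j] positive
  by (cases "j = n") (auto simp: entry_def Suc_le_eq)

lemma expo_le: "i \<le> n \<Longrightarrow> expo i \<le> d"
  using expo_less[of 0 i] by (cases "i = 0") auto

lemma expo_pos: "i < n \<Longrightarrow> 0 < expo i"
  using expo_less[of i n] by (simp add: expo_length)

lemma d_pos: "0 < d"
  using nonempty by (intro expo_pos) auto

lemma expo_less_iff: "i \<le> n \<Longrightarrow> j \<le> n \<Longrightarrow> expo i < expo j \<longleftrightarrow> j < i"
  by (metis expo_less linorder_neqE_nat order_less_asym order_less_irrefl)

lemma expo_eq_iff: "i \<le> n \<Longrightarrow> j \<le> n \<Longrightarrow> expo i = expo j \<longleftrightarrow> i = j"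
  by (metis expo_less linorder_neqE_nat order_less_irrefl)

lemma monomial_expo: "monomial k z w i = z ^ expo i * w ^ (d - expo i)"
  by (simp add: monomial_def)

lemma monomial_first: "monomial k z w 0 = z ^ d"
  by (simp add: monomial_expo)

lemma monomial_last: "monomial k z w n = w ^ d"
  by (simp add: monomial_expo expo_length)

text \<open>Symmetry is stated in terms of the gaps between consecutive exponents; summing the gaps from
  both ends turns it into a reflection of the exponents themselves.\<close>

lemma symmetric_tuple_iff:
  assumes gcd: "Gcd (set k) = 1"
  shows "symmetric_tuple k \<longleftrightarrow> (\<forall>i\<le>n. expo (n - i) = d - expo i)"
proof -
  have eq: "entry k (n - j) - entry k (n - j + 1) = expo (n - Suc j) - expo (n - j)"
    if "j + 2 \<le> n" for j
  proof -
    have "n - j = Suc (n - Suc j)" using that by simp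
    then have "entry k (n - j) = expo (n - Suc j)" by simp
    then show ?thesis by simp
  qed
  have sym: "symmetric_tuple k \<longleftrightarrow>
      (\<forall>j. j + 2 \<le> n \<longrightarrow> expo (n - Suc j) - expo (n - j) = expo j - expo (Suc j))"
    unfolding symmetric_tuple_def using decreasing positive gcd eq by simp
  show ?thesis
  proof
    assume "symmetric_tuple k"
    with sym have gaps: "expo (n - Suc j) - expo (n - j) = expo j - expo (Suc j)"
      if "j + 2 \<le> n" for j
      using that by blast
    have sum: "expo (n - i) + expo i = d" if "i < n" for i
      using that
    proof (induction i)
      case 0
      then show ?case by (simp add: expo_length)
    next
      case (Suc j)
      then have "expo (n - j) < expo (n - Suc j)" "expo (Suc j) < expo j"
        by (auto intro: expo_less)
      with Suc gaps[of j] show ?case by simp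
    qed
    show "\<forall>i\<le>n. expo (n - i) = d - expo i"
    proof (intro allI impI)
      fix i assume "i \<le> n"
      then show "expo (n - i) = d - expo i"
        using sum[of i] by (cases "i = n") (auto simp: expo_length)
    qed
  next
    assume r: "\<forall>i\<le>n. expo (n - i) = d - expo i"
    show "symmetric_tuple k"
      unfolding sym
    proof (intro allI impI)
      fix j assume "j + 2 \<le> n"
      then show "expo (n - Suc j) - expo (n - j) = expo j - expo (Suc j)"
        using r expo_le[of j] by simp
    qed
  qed
qed

text \<open>The map that sends the index of \<open>e\<close> to the index of \<open>d - e\<close> reverses the order.\<close>

lemma complement_closed_imp_reflection:
  assumes "\<And>i. i \<le> n \<Longrightarrow> \<exists>j\<le>n. expo j = d - expo i" and "i \<le> n"
  shows "expo (n - i) = d - expo i"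
proof -
  obtain s where s: "\<And>i. i \<le> n \<Longrightarrow> s i \<le> n \<and> expo (s i) = d - expo i"
    using assms(1) by metis
  have "s j < s i" if "i < j" "j \<le> n" for i j
  proof -
    have "expo (s i) < expo (s j)"
      using s[of i] s[of j] that expo_less[of i j] expo_le[of i] by auto
    then show ?thesis using expo_less_iff[of "s i" "s j"] s[of i] s[of j] that by simp
  qed
  then have "s i = n - i"
    using s \<open>i \<le> n\<close> by (intro strict_antimono_endo_is_reflection) auto
  with s[OF \<open>i \<le> n\<close>] show ?thesis by simp
qed

lemma dvd_if_dvd_expo_mult:
  assumes gcd: "Gcd (set k) = 1" and m: "\<And>i. i \<le> n \<Longrightarrow> c dvd expo i * m"
  shows "c dvd m"
proof -
  have "c dvd m * x" if "x \<in> set k" for x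
  proof -
    obtain i where "i < n" "x = k ! i" using \<open>x \<in> set k\<close> by (auto simp: in_set_conv_nth)
    then show ?thesis using m[of i] by (simp add: entry_def mult.commute)
  qed
  then have "c dvd Gcd ((*) m ` set k)" by (auto intro: Gcd_greatest)
  then show ?thesis using gcd by (simp add: Gcd_mult)
qed

text \<open>This hides the representatives of points of the projective line that enter the definition of the
  curve.\<close>

lemma curve_image_iff:
  "p \<in> curve_image k \<longleftrightarrow> (\<exists>z w. (z \<noteq> 0 \<or> w \<noteq> 0) \<and> p = proj_pt (pt z w))"
proof
  assume "p \<in> curve_image k"
  then obtain v where v: "v \<in> carrier_vec 2" "v \<noteq> 0\<^sub>v 2" "p = monomial_curve k (proj_pt v)"
    unfolding curve_image_def CP_def by (auto simp: numeral_2_eq_2)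
  have "v $ 0 \<noteq> 0 \<or> v $ 1 \<noteq> 0"
  proof (rule ccontr)
    assume "\<not> ?thesis"
    then have "v = 0\<^sub>v 2" using v(1) by (intro eq_vecI) (auto simp: less_2_cases_iff)
    with v(2) show False ..
  qed
  with v show "\<exists>z w. (z \<noteq> 0 \<or> w \<noteq> 0) \<and> p = proj_pt (pt z w)"
    by (auto simp: monomial_curve_proj_pt[OF decreasing v(1)])
next
  assume "\<exists>z w. (z \<noteq> 0 \<or> w \<noteq> 0) \<and> p = proj_pt (pt z w)"
  then obtain z w where zw: "z \<noteq> 0 \<or> w \<noteq> 0" "p = proj_pt (pt z w)" by blast
  define v where "v = vec 2 (\<lambda>i. if i = 0 then z else w)"
  have v: "v \<in> carrier_vec 2" "v $ 0 = z" "v $ 1 = w" by (auto simp: v_def)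
  then have "v \<noteq> 0\<^sub>v 2" using zw(1) by auto
  moreover have "p = monomial_curve k (proj_pt v)"
    using monomial_curve_proj_pt[OF decreasing v(1)] v zw(2) by simp
  ultimately show "p \<in> curve_image k"
    unfolding curve_image_def CP_def using v(1) by (auto simp: numeral_2_eq_2)
qed


section \<open>The stabilizer as a group\<close>

lemma V_group_subgroup: "subgroup (V_group k) (PGL (Suc n))"
proof -
  interpret group "PGL (Suc n)" by (rule group_PGL)
  let ?S = "curve_image k"
  have act: "pgl_act (g \<otimes>\<^bsub>PGL (Suc n)\<^esub> h) ` ?S = pgl_act g ` pgl_act h ` ?S"
    if "g \<in> carrier (PGL (Suc n))" "h \<in> carrier (PGL (Suc n))" for g h
    unfolding image_image
  proof (rule image_cong[OF refl])
    fix p assume "p \<in> ?S"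
    then obtain z w where "p = proj_pt (pt z w)" by (auto simp: curve_image_iff)
    then show "pgl_act (g \<otimes>\<^bsub>PGL (Suc n)\<^esub> h) p = pgl_act g (pgl_act h p)"
      using pgl_act_mult[OF that, of "pt z w"] by simp
  qed
  have one: "pgl_act \<one>\<^bsub>PGL (Suc n)\<^esub> ` ?S = ?S"
  proof -
    have "pgl_act \<one>\<^bsub>PGL (Suc n)\<^esub> p = p" if "p \<in> ?S" for p
      using that by (auto simp: curve_image_iff PGL_one pgl_act_mat_class[of _ "Suc n"])
    then show ?thesis by simp
  qed
  show ?thesis
  proof (rule subgroupI)
    show "V_group k \<subseteq> carrier (PGL (Suc n))" by (auto simp: V_group_def)
    show "V_group k \<noteq> {}" using one by (auto simp: V_group_def)
  next
    fix g assume "g \<in> V_group k"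
    then have g: "g \<in> carrier (PGL (Suc n))" "pgl_act g ` ?S = ?S" by (auto simp: V_group_def)
    have "pgl_act (inv\<^bsub>PGL (Suc n)\<^esub> g) ` ?S = ?S"
      using act[of "inv\<^bsub>PGL (Suc n)\<^esub> g" g] g one by simp
    with g show "inv\<^bsub>PGL (Suc n)\<^esub> g \<in> V_group k" by (simp add: V_group_def)
  next
    fix g h assume "g \<in> V_group k" "h \<in> V_group k"
    then show "g \<otimes>\<^bsub>PGL (Suc n)\<^esub> h \<in> V_group k" by (simp add: V_group_def act)
  qed
qed

text \<open>To lie in the stabilizer it suffices to cover a surjective map of the homogeneous
  parameters.\<close>

lemma V_groupI:
  assumes A: "A \<in> carrier (GL (Suc n))"
    and eq: "\<And>z w. A *\<^sub>v pt z w = pt (f z w) (g z w)"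
    and nz: "\<And>z w. z \<noteq> 0 \<or> w \<noteq> 0 \<Longrightarrow> f z w \<noteq> 0 \<or> g z w \<noteq> 0"
    and surj: "\<And>z w. z \<noteq> 0 \<or> w \<noteq> 0 \<Longrightarrow> \<exists>z' w'. (z' \<noteq> 0 \<or> w' \<noteq> 0) \<and> f z' w' = z \<and> g z' w' = w"
  shows "mat_class (Suc n) A \<in> V_group k"
proof -
  have act: "pgl_act (mat_class (Suc n) A) (proj_pt (pt z w)) = proj_pt (pt (f z w) (g z w))" for z w
    using A by (subst pgl_act_mat_class[of _ "Suc n"]) (auto simp: carrier_GL eq)
  have "pgl_act (mat_class (Suc n) A) ` curve_image k = curve_image k"
  proof (intro equalityI subsetI)
    fix p assume "p \<in> pgl_act (mat_class (Suc n) A) ` curve_image k"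
    then obtain p' where p': "p' \<in> curve_image k" "p = pgl_act (mat_class (Suc n) A) p'" by blast
    then obtain z w where zw: "z \<noteq> 0 \<or> w \<noteq> 0" "p' = proj_pt (pt z w)"
      unfolding curve_image_iff by blast
    then have "p = proj_pt (pt (f z w) (g z w))" using p'(2) act by simp
    with nz[OF zw(1)] show "p \<in> curve_image k" unfolding curve_image_iff by blast
  next
    fix p assume "p \<in> curve_image k"
    then obtain z w where "z \<noteq> 0 \<or> w \<noteq> 0" "p = proj_pt (pt z w)" by (auto simp: curve_image_iff)
    with surj obtain z' w' where "z' \<noteq> 0 \<or> w' \<noteq> 0" "f z' w' = z" "g z' w' = w" by meson
    then have "proj_pt (pt z' w') \<in> curve_image k" by (auto simp: curve_image_iff)
    moreover have "p = pgl_act (mat_class (Suc n) A) (proj_pt (pt z' w'))"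
      using act \<open>f z' w' = z\<close> \<open>g z' w' = w\<close> \<open>p = _\<close> by simp
    ultimately show "p \<in> pgl_act (mat_class (Suc n) A) ` curve_image k" by blast
  qed
  with A show ?thesis by (simp add: V_group_def carrier_PGL)
qed

lemma diag_monomial_GL:
  assumes "a \<noteq> 0" and "b \<noteq> 0"
  shows "mat_diag (Suc n) (monomial k a b) \<in> carrier (GL (Suc n))"
proof (rule carrier_GL_if_inverse)
  let ?B = "mat_diag (Suc n) (\<lambda>i. inverse (monomial k a b i))"
  have "monomial k a b i \<noteq> 0" for i using assms by (simp add: monomial_expo)
  then have "inverse (monomial k a b i) * monomial k a b i = 1" for i by simp
  then show "?B * mat_diag (Suc n) (monomial k a b) = 1\<^sub>m (Suc n)" by simp
qed auto

lemma H_group_subset: "H_group k \<subseteq> V_group k"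
proof
  fix h assume "h \<in> H_group k"
  then obtain a b where ab: "a \<noteq> 0" "b \<noteq> 0"
    and h: "h = mat_class (Suc n) (mat_diag (Suc n) (monomial k a b))"
    by (auto simp: H_group_def)
  have "mat_diag (Suc n) (monomial k a b) *\<^sub>v pt z w = pt (a * z) (b * w)" for z w
  proof (rule eq_vecI)
    fix i assume "i < dim_vec (pt (a * z) (b * w))"
    then show "(mat_diag (Suc n) (monomial k a b) *\<^sub>v pt z w) $ i = pt (a * z) (b * w) $ i"
      by (simp add: mat_diag_def scalar_prod_def sum.delta if_distrib[of "\<lambda>x. x * _"]
          monomial_expo power_mult_distrib del: sum.lessThan_Suc cong: if_cong)
  qed (simp add: mat_diag_def)
  then show "h \<in> V_group k"
    unfolding h
  proof (rule V_groupI[OF diag_monomial_GL[OF ab], where f = "\<lambda>z w. a * z" and g = "\<lambda>z w. b * w"])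
    fix z w :: complex assume "z \<noteq> 0 \<or> w \<noteq> 0"
    then show "\<exists>z' w'. (z' \<noteq> 0 \<or> w' \<noteq> 0) \<and> a * z' = z \<and> b * w' = w"
      using ab by (intro exI[of _ "z / a"] exI[of _ "w / b"]) auto
  qed (use ab in auto)
qed

lemma antidiag_in_V_group:
  assumes "\<And>i. i \<le> n \<Longrightarrow> expo (n - i) = d - expo i"
  shows "mat_class (Suc n) (antidiag_mat n) \<in> V_group k"
proof (rule V_groupI[OF antidiag_GL, where f = "\<lambda>z w. w" and g = "\<lambda>z w. z"])
  fix z w
  show "antidiag_mat n *\<^sub>v pt z w = pt w z"
    by (subst antidiag_mult_vec)
      (auto intro!: eq_vecI simp: monomial_expo assms expo_le less_Suc_eq_le mult.commute)
qed auto


section \<open>Matrices preserving the curve\<close>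

text \<open>A coordinate of the image of the affine point with parameter \<open>t\<close>, as a polynomial in \<open>t\<close>.\<close>

definition row_poly :: "complex mat \<Rightarrow> nat \<Rightarrow> complex poly" where
  "row_poly A i = (\<Sum>j\<le>n. monom (A $$ (i, j)) (expo j))"

lemma poly_row_poly:
  assumes "A \<in> carrier_mat (Suc n) (Suc n)" and "i \<le> n"
  shows "poly (row_poly A i) t = (A *\<^sub>v pt t 1) $ i"
  using assms
  by (auto simp: row_poly_def poly_sum poly_monom scalar_prod_def monomial_expo
      lessThan_Suc_atMost[symmetric] atLeast0LessThan intro!: sum.cong)

lemma coeff_row_poly: "coeff (row_poly A i) m = (\<Sum>j\<le>n. if expo j = m then A $$ (i, j) else 0)"
  by (simp add: row_poly_def coeff_sum)

lemma coeff_row_poly_expo: "j \<le> n \<Longrightarrow> coeff (row_poly A i) (expo j) = A $$ (i, j)"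
proof -
  assume j: "j \<le> n"
  have "coeff (row_poly A i) (expo j) = (\<Sum>j'\<le>n. if j' = j then A $$ (i, j') else 0)"
    unfolding coeff_row_poly by (intro sum.cong) (use j in \<open>auto simp: expo_eq_iff\<close>)
  with j show ?thesis by simp
qed

lemma expo_if_coeff_row_poly_nonzero:
  assumes "coeff (row_poly A i) m \<noteq> 0"
  shows "\<exists>j\<le>n. expo j = m"
proof (rule ccontr)
  assume "\<not> ?thesis"
  then have "coeff (row_poly A i) m = 0"
    unfolding coeff_row_poly by (intro sum.neutral) auto
  with assms show False ..
qed

lemma degree_row_poly: "degree (row_poly A i) \<le> d"
  using expo_if_coeff_row_poly_nonzero expo_le by (intro degree_le) (metis linorder_not_le)

text \<open>For \<open>r \<noteq> 0\<close> the binomial expansion has \<open>d + 1\<close> nonzero coefficients, more than there are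
  exponents. This is where the curve has to differ from the rational normal curve.\<close>

lemma linear_power_row_poly_centered:
  assumes gap: "n < d" and eq: "row_poly A i = smult c ([:- r, 1:] ^ d)" and "c \<noteq> 0"
  shows "r = 0"
proof (rule ccontr)
  assume "r \<noteq> 0"
  have "m \<in> expo ` {..n}" if "m \<le> d" for m
  proof -
    have "coeff (row_poly A i) m \<noteq> 0"
      unfolding eq using \<open>m \<le> d\<close> \<open>r \<noteq> 0\<close> \<open>c \<noteq> 0\<close>
      by (simp add: coeff_linear_poly_power)
    then show ?thesis using expo_if_coeff_row_poly_nonzero by force
  qed
  then have "{..d} \<subseteq> expo ` {..n}" by auto
  then have "card {..d} \<le> card {..n}" by (meson card_image_le card_mono finite_atMost finite_imageI le_trans)
  with gap show False by simp
qed

end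

locale curve_automorphism = exponent_tuple +
  fixes A :: "complex mat"
  assumes gap: "n < d" and gcd: "Gcd (set k) = 1"
    and A: "A \<in> carrier_mat (Suc n) (Suc n)" and det: "det A \<noteq> 0"
    and preserves: "pgl_act (mat_class (Suc n) A) ` curve_image k \<subseteq> curve_image k"
begin

abbreviation "q \<equiv> row_poly A"

lemma row_poly_on_curve:
  "\<exists>c z w. c \<noteq> 0 \<and> (z \<noteq> 0 \<or> w \<noteq> 0) \<and> (\<forall>i\<le>n. poly (q i) t = c * monomial k z w i)"
proof -
  have "proj_pt (pt t 1) \<in> curve_image k" unfolding curve_image_iff
    by (rule exI[of _ t], rule exI[of _ 1]) simp
  with preserves have "pgl_act (mat_class (Suc n) A) (proj_pt (pt t 1)) \<in> curve_image k" by blast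
  then have "proj_pt (A *\<^sub>v pt t 1) \<in> curve_image k"
    using pgl_act_mat_class[OF A, of "pt t 1"] by simp
  then obtain z w where zw: "z \<noteq> 0 \<or> w \<noteq> 0" "proj_pt (A *\<^sub>v pt t 1) = proj_pt (pt z w)"
    unfolding curve_image_iff by blast
  have "1 \<cdot>\<^sub>v (A *\<^sub>v pt t 1) \<in> proj_pt (A *\<^sub>v pt t 1)"
    unfolding proj_pt_def using one_neq_zero by blast
  then have "A *\<^sub>v pt t 1 \<in> proj_pt (pt z w)" unfolding zw(2) by simp
  then obtain c where c: "c \<noteq> 0" "A *\<^sub>v pt t 1 = c \<cdot>\<^sub>v pt z w"
    unfolding proj_pt_def by blast
  have "poly (q i) t = c * monomial k z w i" if "i \<le> n" for i
    unfolding poly_row_poly[OF A that] c(2) using that by simp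
  with c(1) zw(1) show ?thesis by blast
qed

text \<open>The binomial equations \<open>x\<^sub>i^d = x\<^sub>0^e\<^sub>i x\<^sub>n^(d - e\<^sub>i)\<close> hold on the curve, and a polynomial identity
  over the complex numbers may be checked pointwise.\<close>

lemma row_poly_binomial:
  assumes "i \<le> n"
  shows "q i ^ d = q 0 ^ expo i * q n ^ (d - expo i)"
proof (rule poly_ext)
  fix t
  obtain c z w where c: "\<And>i. i \<le> n \<Longrightarrow> poly (q i) t = c * monomial k z w i"
    using row_poly_on_curve[of t] by metis
  have "c ^ d = c ^ expo i * c ^ (d - expo i)"
    using expo_le[OF assms] by (simp flip: power_add)
  then show "poly (q i ^ d) t = poly (q 0 ^ expo i * q n ^ (d - expo i)) t"
    using assms
    by (simp add: c monomial_first monomial_last)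
      (simp add: monomial_expo power_mult_distrib mult_ac flip: power_mult)
qed

text \<open>On the curve the first and the last coordinate are \<open>z^d\<close> and \<open>w^d\<close>, up to a common nonzero
  factor, and \<open>z\<close> and \<open>w\<close> are not both zero.\<close>

lemma no_common_root: "poly (q 0) t \<noteq> 0 \<or> poly (q n) t \<noteq> 0"
proof -
  obtain c z w where "c \<noteq> 0" "z \<noteq> 0 \<or> w \<noteq> 0"
    and c: "\<And>i. i \<le> n \<Longrightarrow> poly (q i) t = c * monomial k z w i"
    using row_poly_on_curve[of t] by metis
  then show ?thesis by (auto simp: c monomial_first monomial_last)
qed

lemma two_sided_inverse:
  "\<exists>B\<in>carrier_mat (Suc n) (Suc n). A * B = 1\<^sub>m (Suc n) \<and> B * A = 1\<^sub>m (Suc n)"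
  using det_non_zero_imp_unit[OF A det, of "()"] by (auto simp: Units_def ring_mat_simps)

lemma row_poly_nonzero:
  assumes "i \<le> n" shows "q i \<noteq> 0"
proof
  assume "q i = 0"
  then have z: "A $$ (i, j) = 0" if "j \<le> n" for j
    using coeff_row_poly_expo[OF that, of A i] by simp
  obtain B where B: "B \<in> carrier_mat (Suc n) (Suc n)" "A * B = 1\<^sub>m (Suc n)"
    using two_sided_inverse by blast
  have "(A * B) $$ (i, i) = 1" using assms by (simp add: B)
  moreover have "(A * B) $$ (i, i) = 0"
    using A B(1) assms by (auto simp: scalar_prod_def z intro!: sum.neutral)
  ultimately show False by simp
qed

lemma column_nonzero:
  assumes "j \<le> n" shows "\<exists>i\<le>n. A $$ (i, j) \<noteq> 0"
proof (rule ccontr)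
  assume "\<not> ?thesis"
  then have z: "A $$ (i, j) = 0" if "i \<le> n" for i using that by blast
  obtain B where B: "B \<in> carrier_mat (Suc n) (Suc n)" "B * A = 1\<^sub>m (Suc n)"
    using two_sided_inverse by blast
  have "(B * A) $$ (j, j) = 1" using assms by (simp add: B)
  moreover have "(B * A) $$ (j, j) = 0"
    using A B(1) assms by (auto simp: scalar_prod_def z intro!: sum.neutral)
  ultimately show False by simp
qed

text \<open>At a root of one end polynomial the other one does not vanish, so the binomial equations express
  \<open>d\<close> times an order as \<open>e\<^sub>i\<close> or \<open>d - e\<^sub>i\<close> times the order of that root; coprimality of the
  exponents then makes the order divisible by \<open>d\<close>.\<close>

lemma end_row_cases:
  assumes i: "i \<in> {0, n}"
  shows "\<exists>c. c \<noteq> 0 \<and> (q i = monom c 0 \<or> q i = monom c d)"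
proof -
  have nz: "q 0 \<noteq> 0" "q n \<noteq> 0" "q i \<noteq> 0" using i row_poly_nonzero by auto
  have "d dvd Polynomial.order r (q i)" for r
  proof (cases "poly (q i) r = 0")
    case False
    then show ?thesis by (simp add: order_0I)
  next
    case True
    let ?o = "\<lambda>i. Polynomial.order r (q i)"
    have eq: "d * ?o j = expo j * ?o 0 + (d - expo j) * ?o n" if "j \<le> n" for j
      using arg_cong[OF row_poly_binomial[OF that], of "Polynomial.order r"] nz row_poly_nonzero[OF that]
      by (simp add: order_power order_mult)
    show ?thesis
    proof (rule dvd_if_dvd_expo_mult[OF gcd])
      fix j assume j: "j \<le> n"
      show "d dvd expo j * ?o i"
      proof (cases "i = 0")
        case 0: True
        with True have "poly (q n) r \<noteq> 0" using no_common_root[of r] by simp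
        then have "d * ?o j = expo j * ?o i" using eq[OF j] 0 by (simp add: order_0I)
        then show ?thesis by (metis dvd_triv_left)
      next
        case False
        with i True have "i = n" "poly (q 0) r \<noteq> 0" using no_common_root[of r] by auto
        then have "d * ?o j = (d - expo j) * ?o i" using eq[OF j] by (simp add: order_0I)
        then have "d * ?o j + expo j * ?o i = d * ?o i"
          using expo_le[OF j] by (simp flip: add_mult_distrib)
        then show ?thesis by (metis dvd_add_right_iff dvd_triv_left)
      qed
    qed
  qed
  from poly_power_linear_if_orders_divisible[OF nz(3) degree_row_poly this]
  show ?thesis
  proof (elim disjE exE conjE)
    fix c assume "q i = [:c:]"
    with nz(3) show ?thesis by (auto simp: monom_0 intro!: exI[of _ c])
  next
    fix c r assume c: "c \<noteq> 0" and eq: "q i = smult c ([:- r, 1:] ^ d)"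
    have "r = 0" using linear_power_row_poly_centered[OF gap eq c] .
    with c eq show ?thesis by (auto simp: monom_altdef intro!: exI[of _ c])
  qed
qed

text \<open>The two remaining combinations of end polynomials are impossible: if both are constant, so are
  all coordinates, and the column of \<open>A\<close> that belongs to \<open>t^d\<close> vanishes; if both are multiples of
  \<open>t^d\<close>, they have the common root \<open>0\<close>.\<close>

lemma row_polys_monom:
  "(\<forall>i\<le>n. \<exists>c. c \<noteq> 0 \<and> q i = monom c (expo i)) \<or> (\<forall>i\<le>n. \<exists>c. c \<noteq> 0 \<and> q i = monom c (d - expo i))"
proof -
  obtain a a' where a: "a \<noteq> 0" "q 0 = monom a a'" "a' = 0 \<or> a' = d"
    using end_row_cases[of 0] by auto
  obtain b b' where b: "b \<noteq> 0" "q n = monom b b'" "b' = 0 \<or> b' = d"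
    using end_row_cases[of n] by auto
  have pow: "\<exists>c. c \<noteq> 0 \<and> q i = monom c m"
    if "i \<le> n" and m: "a' * expo i + b' * (d - expo i) = d * m" for i m
  proof (rule monom_if_power_monom)
    show "q i ^ d = monom (a ^ expo i * b ^ (d - expo i)) (d * m)"
      using row_poly_binomial[OF \<open>i \<le> n\<close>] by (simp add: a b monom_power mult_monom flip: m)
  qed (use a b d_pos in auto)
  consider "a' = d" "b' = 0" | "a' = 0" "b' = d" | "a' = 0" "b' = 0" | "a' = d" "b' = d"
    using a b by blast
  then show ?thesis
  proof cases
    case 1 then show ?thesis using pow by auto
  next
    case 2 then show ?thesis using pow by auto
  next
    case 3
    obtain i where i: "i \<le> n" "A $$ (i, 0) \<noteq> 0" using column_nonzero[of 0] by auto
    obtain c where "q i = monom c 0" using pow[of i 0] 3 i by auto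
    then have False using coeff_row_poly_expo[of 0 A i] i d_pos by simp
    then show ?thesis ..
  next
    case 4
    then have False using no_common_root[of 0] a b d_pos by (simp add: poly_monom)
    then show ?thesis ..
  qed
qed

text \<open>Row \<open>i\<close> of \<open>A\<close> has a single nonzero entry, the value of its polynomial at \<open>1\<close>; these values
  are the coordinates of a point of the curve, and its parameters serve as the parameters of the
  diagonal matrix.\<close>

lemma mat_class_cases:
  "mat_class (Suc n) A \<in> H_group k \<or>
   (symmetric_tuple k \<and>
    (\<exists>h\<in>H_group k. mat_class (Suc n) A = h \<otimes>\<^bsub>PGL (Suc n)\<^esub> mat_class (Suc n) (antidiag_mat n)))"
proof -
  obtain c z w where c: "c \<noteq> 0" and "z \<noteq> 0 \<or> w \<noteq> 0"
    and row_sum: "\<And>i. i \<le> n \<Longrightarrow> poly (q i) 1 = c * monomial k z w i"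
    using row_poly_on_curve[of 1] by metis
  let ?D = "mat_diag (Suc n) (monomial k z w)"
  have A_eq: "A $$ (i, j) = (if expo j = f i then c * monomial k z w i else 0) \<and> monomial k z w i \<noteq> 0"
    if m: "\<forall>i\<le>n. \<exists>c. c \<noteq> 0 \<and> q i = monom c (f i)" and ij: "i \<le> n" "j \<le> n" for f i j
  proof -
    obtain b where b: "b \<noteq> 0" "q i = monom b (f i)" using m ij(1) by metis
    then have "b = c * monomial k z w i" using row_sum[of i] ij by (simp add: poly_monom)
    then show ?thesis using coeff_row_poly_expo[of j A i] ij b by auto
  qed
  have zw: "z \<noteq> 0 \<and> w \<noteq> 0"
  proof -
    have "monomial k z w i \<noteq> 0" if "i \<le> n" for i
      using row_polys_monom A_eq[of expo i i] A_eq[of "\<lambda>i. d - expo i" i i] that by blast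
    then have "monomial k z w 0 \<noteq> 0 \<and> monomial k z w n \<noteq> 0" by simp
    then show ?thesis using d_pos by (simp add: monomial_first monomial_last)
  qed
  have H: "mat_class (Suc n) ?D \<in> H_group k" using zw by (auto simp: H_group_def)
  have scale: "mat_class (Suc n) (c \<cdot>\<^sub>m B) = mat_class (Suc n) B" if "B \<in> carrier_mat (Suc n) (Suc n)" for B
    using mat_class_smult[OF that c] .
  from row_polys_monom show ?thesis
  proof
    assume m: "\<forall>i\<le>n. \<exists>c. c \<noteq> 0 \<and> q i = monom c (expo i)"
    have "A = c \<cdot>\<^sub>m ?D"
      using A A_eq[OF m] by (intro eq_matI) (auto simp: mat_diag_def less_Suc_eq_le expo_eq_iff)
    then show ?thesis using H scale[of ?D] by simp
  next
    assume m: "\<forall>i\<le>n. \<exists>c. c \<noteq> 0 \<and> q i = monom c (d - expo i)"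
    have "\<exists>j\<le>n. expo j = d - expo i" if "i \<le> n" for i
      using m that expo_if_coeff_row_poly_nonzero[of A i "d - expo i"] by auto
    then have reflect: "expo (n - i) = d - expo i" if "i \<le> n" for i
      using complement_closed_imp_reflection that by blast
    have "A = c \<cdot>\<^sub>m (?D * antidiag_mat n)"
    proof (rule eq_matI)
      fix i j assume "i < dim_row (c \<cdot>\<^sub>m (?D * antidiag_mat n))" "j < dim_col (c \<cdot>\<^sub>m (?D * antidiag_mat n))"
      then have ij: "i \<le> n" "j \<le> n" by (auto simp: antidiag_mat_def mat_diag_def)
      have "expo j = d - expo i \<longleftrightarrow> i + j = n"
        using ij by (auto simp: reflect[symmetric] expo_eq_iff)
      then show "A $$ (i, j) = (c \<cdot>\<^sub>m (?D * antidiag_mat n)) $$ (i, j)"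
        using A_eq[OF m ij] ij by (subst mat_diag_mult_left[of _ _ "Suc n"]) (auto simp: antidiag_mat_def)
    qed (use A in \<open>auto simp: antidiag_mat_def mat_diag_def\<close>)
    moreover have "?D * antidiag_mat n \<in> carrier_mat (Suc n) (Suc n)"
      by (auto simp: antidiag_mat_def mat_diag_def)
    ultimately have "mat_class (Suc n) A = mat_class (Suc n) ?D \<otimes>\<^bsub>PGL (Suc n)\<^esub> mat_class (Suc n) (antidiag_mat n)"
      using scale[of "?D * antidiag_mat n"] antidiag_GL diag_monomial_GL[of z w] zw
      by (simp add: mat_class_mult carrier_GL)
    then show ?thesis using H reflect symmetric_tuple_iff[OF gcd] by blast
  qed
qed

end

theorem theorem5p6:
  fixes n :: nat and k :: "nat list"
  assumes "n \<ge> 1" and "length k = n"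
    and "sorted_wrt (>) k" and "\<forall>x\<in>set k. 1 \<le> x"
    and "entry k 1 > n" and "Gcd (set k) = 1"
  shows "(symmetric_tuple k \<longrightarrow>
        V_group k = generate (PGL (n + 1)) (H_group k \<union> {mat_class (n + 1) (antidiag_mat n)}))
      \<and> (\<not> symmetric_tuple k \<longrightarrow> V_group k = H_group k)"
proof -
  interpret exponent_tuple k using assms by unfold_locales auto
  let ?J = "mat_class (n + 1) (antidiag_mat n)"
  interpret PGL: group "PGL (n + 1)" by (rule group_PGL)
  have cases: "g \<in> H_group k \<or> symmetric_tuple k \<and> (\<exists>h\<in>H_group k. g = h \<otimes>\<^bsub>PGL (n + 1)\<^esub> ?J)"
    if g: "g \<in> V_group k" for g
  proof -
    obtain A where GA: "A \<in> carrier (GL (n + 1))" "g = mat_class (n + 1) A"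
      using g assms(2) by (auto simp: V_group_def carrier_PGL)
    interpret curve_automorphism k A
      by unfold_locales (use GA g assms in \<open>auto simp: V_group_def carrier_GL\<close>)
    show ?thesis using mat_class_cases GA assms(2) by simp
  qed
  show ?thesis
  proof (intro conjI impI)
    assume sym: "symmetric_tuple k"
    show "V_group k = generate (PGL (n + 1)) (H_group k \<union> {?J})"
    proof
      show "V_group k \<subseteq> generate (PGL (n + 1)) (H_group k \<union> {?J})"
        using cases by (blast intro: generate.incl generate.eng)
      have "?J \<in> V_group k"
        using antidiag_in_V_group sym symmetric_tuple_iff assms by simp
      then show "generate (PGL (n + 1)) (H_group k \<union> {?J}) \<subseteq> V_group k"
        using H_group_subset V_group_subgroup assms(2) by (intro PGL.generate_subgroup_incl) auto
    qed
  next
    assume "\<not> symmetric_tuple k"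
    then show "V_group k = H_group k" using cases H_group_subset by blast
  qed
qed

end
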